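(* Let $H\in(0,\frac12)$, $\tilde\theta>0$, $\rho>1+\frac{1}{H\tilde\theta}$, $\tilde\sigma>0$, $\alpha_{-1},\alpha_0,\alpha_1,\alpha_2>0$ and $x>0$, and let $B^H=(B^H_t)_{0\le t\le1}$ be a scalar fractional Brownian motion with Hurst parameter $H$. Let $x_t$, $0\le t\le 1$, be the (unique strong positive) solution to $$x_t=x+\int_0^t\tilde f(s,x_s)\,ds-\tilde\sigma B^H_t,\qquad 0\le t\le1,$$ where for $0<s\le1$ and $0<y<\infty$ $$\tilde f(s,y)=-\alpha_{-1}\tilde\theta\, y^{2\tilde\theta+1}+\alpha_0y^{\tilde\theta+1}-\alpha_1\frac{y}{\tilde\theta}+\alpha_2 s^{2H-1}\frac{1}{\tilde\theta^{\rho}}\,y^{-\tilde\theta\rho+\tilde\theta+1}-\tilde\sigma Hs^{2H-1}(\tilde\theta+1)y^{-1}.$$ Then $x_t\in L^q(\Omega)$ for all $q\ge1$ and all $0\le t\le1$.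
   Context: A scalar fractional Brownian motion with Hurst parameter $H$ is a centred continuous Gaussian process on $[0,1]$ with covariance $\mathbb{E}[B^H_tB^H_s]=\frac12(t^{2H}+s^{2H}-|t-s|^{2H})$, defined on a complete probability space $(\Omega,\mathcal F,\mathbb P)$. A strong positive solution is a continuous process, adapted to the ($\mathbb P$-completed) filtration generated by $B^H$, with $x_t>0$ for all $t\in[0,1]$ almost surely, such that the equation holds for all $t\in[0,1]$ almost surely; unique means that any two such solutions coincide for all $t\in[0,1]$ almost surely. *)

theory Defs
  imports "HOL-Probability.Probability"
begin

text \<open>
  Processes on the time interval \<open>[0,1]\<close> are functions \<open>X :: real \<Rightarrow> 'w \<Rightarrow> real\<close> of time and
  outcome; their values at times outside \<open>[0,1]\<close> are irrelevant.
\<close>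

text \<open>A point mass counts as a (degenerate) Gaussian law.\<close>

definition gaussian_rv :: "'w measure \<Rightarrow> ('w \<Rightarrow> real) \<Rightarrow> bool" where
  "gaussian_rv M Y \<longleftrightarrow> Y \<in> borel_measurable M \<and>
     ((\<exists>\<mu> \<sigma>. \<sigma> > 0 \<and> distributed M lborel Y (normal_density \<mu> \<sigma>)) \<or> (\<exists>\<mu>. AE \<omega> in M. Y \<omega> = \<mu>))"

definition gaussian_process_on :: "real set \<Rightarrow> 'w measure \<Rightarrow> (real \<Rightarrow> 'w \<Rightarrow> real) \<Rightarrow> bool" where
  "gaussian_process_on T M Y \<longleftrightarrow> (\<forall>t\<in>T. Y t \<in> borel_measurable M) \<and>
     (\<forall>J c. finite J \<and> J \<subseteq> T \<longrightarrow> gaussian_rv M (\<lambda>\<omega>. \<Sum>t\<in>J. c t * Y t \<omega>))"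

definition fractional_brownian_motion :: "'w measure \<Rightarrow> real \<Rightarrow> (real \<Rightarrow> 'w \<Rightarrow> real) \<Rightarrow> bool" where
  "fractional_brownian_motion M H B \<longleftrightarrow>
     gaussian_process_on {0..1} M B \<and>
     (\<forall>t\<in>{0..1}. prob_space.expectation M (B t) = 0) \<and>
     (\<forall>s\<in>{0..1}. \<forall>t\<in>{0..1}. prob_space.expectation M (\<lambda>\<omega>. B t \<omega> * B s \<omega>)
        = 1/2 * (t powr (2*H) + s powr (2*H) - \<bar>t - s\<bar> powr (2*H))) \<and>
     (AE \<omega> in M. continuous_on {0..1} (\<lambda>t. B t \<omega>))"

definition completed_filtration :: "'w measure \<Rightarrow> (real \<Rightarrow> 'w \<Rightarrow> real) \<Rightarrow> real \<Rightarrow> 'w measure" where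
  "completed_filtration M B t =
     sigma (space M) ({B s -` A \<inter> space M | s A. s \<in> {0..t} \<and> A \<in> sets borel} \<union> null_sets M)"

text \<open>
  The equation is \<open>X\<^sub>t = x + \<integral>\<^sub>0\<^sup>t f(s, X\<^sub>s) ds - \<sigma> B\<^sub>t\<close>. Integrability is required explicitly
  because the Lebesgue integral of a non-integrable function is \<open>0\<close> by convention.
\<close>

definition strong_positive_solution ::
  "'w measure \<Rightarrow> (real \<Rightarrow> 'w \<Rightarrow> real) \<Rightarrow> (real \<Rightarrow> real \<Rightarrow> real) \<Rightarrow> real \<Rightarrow> real \<Rightarrow> (real \<Rightarrow> 'w \<Rightarrow> real) \<Rightarrow> bool"
where
  "strong_positive_solution M B f \<sigma> x X \<longleftrightarrow>
     (\<forall>t\<in>{0..1}. X t \<in> borel_measurable (completed_filtration M B t)) \<and>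
     (AE \<omega> in M. continuous_on {0..1} (\<lambda>t. X t \<omega>)) \<and>
     (AE \<omega> in M. \<forall>t\<in>{0..1}. X t \<omega> > 0) \<and>
     (AE \<omega> in M. \<forall>t\<in>{0..1}.
        set_integrable lborel {0..t} (\<lambda>s. f s (X s \<omega>)) \<and>
        X t \<omega> = x + (LINT s:{0..t}|lborel. f s (X s \<omega>)) - \<sigma> * B t \<omega>)"

text \<open>
  Only the values for \<open>0 < s \<le> 1\<close> and \<open>y > 0\<close> matter: \<open>{0}\<close> is a Lebesgue null set, and solutions
  are positive. The argument \<open>am1\<close> is the coefficient with index \<open>-1\<close>.
\<close>

definition drift ::
  "real \<Rightarrow> real \<Rightarrow> real \<Rightarrow> real \<Rightarrow> real \<Rightarrow> real \<Rightarrow> real \<Rightarrow> real \<Rightarrow> real \<Rightarrow> real \<Rightarrow> real"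
where
  "drift H \<theta> \<rho> \<sigma> am1 a0 a1 a2 s y =
     - am1 * \<theta> * y powr (2*\<theta> + 1) + a0 * y powr (\<theta> + 1) - a1 * (y / \<theta>)
     + a2 * s powr (2*H - 1) * (1 / \<theta> powr \<rho>) * y powr (- \<theta> * \<rho> + \<theta> + 1)
     - \<sigma> * H * s powr (2*H - 1) * (\<theta> + 1) * y powr (-1)"

definition Lq_space :: "'w measure \<Rightarrow> real \<Rightarrow> ('w \<Rightarrow> real) set" where
  "Lq_space M q = {Y \<in> borel_measurable M. integrable M (\<lambda>\<omega>. \<bar>Y \<omega>\<bar> powr q)}"

end

theory Submission
  imports Defs
begin

text \<open>
  Since \<open>\<theta> * \<rho> > \<theta> + 1 / H > \<theta> + 2\<close>, for large \<open>y\<close> the repelling term of the drift is dominated by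
  the \<open>y powr (-1)\<close> term, which carries the same singular factor \<open>s powr (2*H - 1)\<close>. Hence the
  drift is nonpositive above some level \<open>K \<ge> x\<close>, uniformly in time. Looking back to the last time
  at which the solution was below \<open>K\<close> gives \<open>X t \<le> K + 2 * \<sigma> * sup \<bar>B\<bar>\<close> pathwise, and the
  supremum of \<open>B\<close> has moments of all orders by Kolmogorov's chaining argument, because the Gaussian
  increments satisfy \<open>E \<bar>B t - B s\<bar>^(2*k) = C * \<bar>t - s\<bar> powr (2*H*k)\<close>.
\<close>

section \<open>Even moments of centred Gaussian variables\<close>

lemma gaussian_rv_even_moment:
  assumes "prob_space M" and G: "gaussian_rv M Y" and mean: "prob_space.expectation M Y = 0"
  shows "integrable M (\<lambda>\<omega>. Y \<omega> ^ (2*k))"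
    and "(\<integral>\<omega>. Y \<omega> ^ (2*k) \<partial>M) = fact (2*k) / (2^k * fact k) * (\<integral>\<omega>. (Y \<omega>)\<^sup>2 \<partial>M) ^ k"
proof -
  interpret prob_space M by fact
  have meas[measurable]: "Y \<in> borel_measurable M"
    using G by (simp add: gaussian_rv_def)
  have "integrable M (\<lambda>\<omega>. Y \<omega> ^ (2*k)) \<and>
    (\<integral>\<omega>. Y \<omega> ^ (2*k) \<partial>M) = fact (2*k) / (2^k * fact k) * (\<integral>\<omega>. (Y \<omega>)\<^sup>2 \<partial>M) ^ k"
  proof (cases "\<exists>\<mu> \<sigma>. \<sigma> > 0 \<and> distributed M lborel Y (normal_density \<mu> \<sigma>)")
    case True
    then obtain \<mu> \<sigma> where pos: "\<sigma> > 0" and D: "distributed M lborel Y (normal_density \<mu> \<sigma>)"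
      by blast
    have "\<mu> = 0"
      using normal_distributed_expectation[OF pos D] mean by simp
    have int: "integrable M (\<lambda>\<omega>. Y \<omega> ^ (2*j))" for j
      using distributed_integrable[OF D, of "\<lambda>y. y ^ (2*j)"]
        integrable_normal_moment[OF pos, of \<mu> "2*j"] \<open>\<mu> = 0\<close> by simp
    have mom: "(\<integral>\<omega>. Y \<omega> ^ (2*j) \<partial>M) = fact (2*j) / (2^j * fact j) * (\<sigma>\<^sup>2) ^ j" for j
      using distributed_integral[OF D, of "\<lambda>y. y ^ (2*j)"]
        integral_normal_moment_even[OF pos, of \<mu> j] \<open>\<mu> = 0\<close>
      by (simp add: power_divide field_simps)
    \<comment> \<open>The instance \<open>j = 1\<close> identifies \<open>\<sigma>\<^sup>2\<close>
      with the second moment, which eliminates \<open>\<sigma>\<close> from the formula.\<close>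
    show ?thesis
      using int mom[of k] mom[of 1] by simp
  next
    case False
    then obtain \<mu> where \<mu>: "AE \<omega> in M. Y \<omega> = \<mu>"
      using G by (auto simp: gaussian_rv_def)
    have "expectation Y = (\<integral>\<omega>. \<mu> \<partial>M)"
      by (rule integral_cong_AE) (use \<mu> in auto)
    then have "\<mu> = 0"
      using mean by (simp add: prob_space)
    \<comment> \<open>Writing \<open>0 ^ (2*j)\<close> rather than 0 includes \<open>j = 0\<close>,
      where the moment is 1 because \<open>0 ^ 0 = 1\<close>.\<close>
    have AE: "AE \<omega> in M. Y \<omega> ^ (2*j) = 0 ^ (2*j)" for j
      using \<mu> \<open>\<mu> = 0\<close> by auto
    have mom: "(\<integral>\<omega>. Y \<omega> ^ (2*j) \<partial>M) = 0 ^ (2*j)" for j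
      using integral_cong_AE[OF _ _ AE[of j]] by (simp add: prob_space)
    have "integrable M (\<lambda>\<omega>. Y \<omega> ^ (2*k))"
      using integrable_cong_AE[OF _ _ AE[of k]] by simp
    then show ?thesis
      using mom[of k] mom[of 1] by (cases k) simp_all
  qed
  then show "integrable M (\<lambda>\<omega>. Y \<omega> ^ (2*k))"
    and "(\<integral>\<omega>. Y \<omega> ^ (2*k) \<partial>M) = fact (2*k) / (2^k * fact k) * (\<integral>\<omega>. (Y \<omega>)\<^sup>2 \<partial>M) ^ k"
    by auto
qed

section \<open>Dyadic chaining and moments of the supremum\<close>

text \<open>A dyadic point is reached from 0 by using at most one increment of each level, so the
  increments add up to a geometric series. Continuity carries the bound from the dyadic points to
  all of \<open>{0..1}\<close>.\<close>

lemma dyadic_chaining: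
  fixes b :: "real \<Rightarrow> real"
  assumes cont: "continuous_on {0..1} b" and "b 0 = 0"
    and A: "0 \<le> A" and r: "0 \<le> r" "r < 1"
    and incr: "\<And>n k. k < 2^n \<Longrightarrow> \<bar>b (real (Suc k) / 2^n) - b (real k / 2^n)\<bar> \<le> A * r^n"
    and t: "t \<in> {0..1}"
  shows "\<bar>b t\<bar> \<le> A / (1 - r)"
proof -
  have dyadic: "\<bar>b (real k / 2^n)\<bar> \<le> A * (\<Sum>m\<le>n. r^m)" if "k \<le> 2^n" for k n
    using that
  proof (induction n arbitrary: k)
    case 0
    then consider "k = 0" | "k = 1" by (auto simp: le_Suc_eq)
    then show ?case
      using incr[of 0 0] \<open>b 0 = 0\<close> A by cases auto
  next
    case (Suc n)
    have sum: "A * (\<Sum>m\<le>Suc n. r^m) = A * (\<Sum>m\<le>n. r^m) + A * r^Suc n"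
      by (simp add: algebra_simps)
    have nn: "0 \<le> A * r^Suc n"
      using A r by simp
    show ?case
    proof (cases "even k")
      case True
      then obtain j where "k = 2*j" by blast
      then have "\<bar>b (real k / 2^Suc n)\<bar> \<le> A * (\<Sum>m\<le>n. r^m)"
        using Suc.IH[of j] Suc.prems by simp
      then show ?thesis
        using sum nn by linarith
    next
      case False
      then obtain j where j: "k = Suc (2*j)"
        by (auto elim: oddE)
      then have "real (2*j) / 2^Suc n = real j / 2^n"
        by simp
      then have "\<bar>b (real (2*j) / 2^Suc n)\<bar> \<le> A * (\<Sum>m\<le>n. r^m)"
        using Suc.IH[of j] Suc.prems j by simp
      moreover have "\<bar>b (real k / 2^Suc n) - b (real (2*j) / 2^Suc n)\<bar> \<le> A * r^Suc n"
        using incr[of "2*j" "Suc n"] Suc.prems unfolding j by simp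
      ultimately show ?thesis
        using sum by linarith
    qed
  qed
  have geo: "(\<Sum>m\<le>n. r^m) \<le> 1 / (1 - r)" for n
    using sum_le_suminf[of "\<lambda>m. r^m" "{..n}"] summable_geometric[of r] suminf_geometric[of r] r
    by simp
  have bd: "\<bar>b (real k / 2^n)\<bar> \<le> A / (1 - r)" if "k \<le> 2^n" for k n
    using dyadic[OF that] mult_left_mono[OF geo A, of n] by simp
  \<comment> \<open>\<open>u n\<close> is the largest dyadic point of level \<open>n\<close> not
    exceeding \<open>t\<close>. At \<open>t = 1\<close> its index equals \<open>2^n\<close>, which
    is why \<open>bd\<close> admits \<open>k \<le> 2^n\<close> although increments start only at
    \<open>k < 2^n\<close>.\<close>
  define u where "u n = real (nat \<lfloor>t * 2^n\<rfloor>) / 2^n" for n :: nat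
  have u_eq: "u n = of_int \<lfloor>t * 2^n\<rfloor> / 2^n" for n
    using t by (simp add: u_def)
  have le: "nat \<lfloor>t * 2^n\<rfloor> \<le> 2^n" for n
  proof -
    have "t * 2^n \<le> 2^n"
      using t by (simp add: mult_left_le_one_le)
    then have "\<lfloor>t * 2^n\<rfloor> \<le> \<lfloor>(2::real)^n\<rfloor>"
      by (rule floor_mono)
    then show ?thesis
      by (simp add: nat_le_iff)
  qed
  have u_in: "u n \<in> {0..1}" for n
    using le[of n] by (auto simp: u_def divide_le_eq_1 simp flip: of_nat_le_iff)
  have "t - (1/2)^n \<le> u n" "u n \<le> t" for n
  proof -
    have "(t - (1/2)^n) * 2^n \<le> u n * 2^n" "u n * 2^n \<le> t * 2^n"
      using floor_correct[of "t * 2^n"] unfolding u_eq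
      by (auto simp: left_diff_distrib simp flip: power_mult_distrib)
    then show "t - (1/2)^n \<le> u n" "u n \<le> t"
      by simp_all
  qed
  moreover have "(\<lambda>n. t - (1/2)^n) \<longlonglongrightarrow> t"
    using tendsto_diff[OF tendsto_const LIMSEQ_realpow_zero[of "1/2::real"], of t] by simp
  ultimately have "u \<longlonglongrightarrow> t"
    by (intro real_tendsto_sandwich[of "\<lambda>n. t - (1/2)^n" u _ "\<lambda>_. t"]) auto
  then have "(\<lambda>n. b (u n)) \<longlonglongrightarrow> b t"
    using continuous_on_tendsto_compose[OF cont, of u t] t u_in by auto
  then have "(\<lambda>n. \<bar>b (u n)\<bar>) \<longlonglongrightarrow> \<bar>b t\<bar>"
    by (rule tendsto_rabs)
  then show ?thesis
    by (rule LIMSEQ_le_const2) (use bd le in \<open>auto simp: u_def\<close>)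
qed

text \<open>
  With \<open>F n\<close> the weighted sum of \<open>p\<close>-th powers of the level-\<open>n\<close> dyadic increments, the weight \<open>R^n\<close>
  is small enough for \<open>\<Sum>n. F n\<close> to have finite mean, yet large enough for each
  level-\<open>n\<close> increment to be at most \<open>root p (\<Sum>n. F n) * r^n\<close> with \<open>r < 1\<close>.
\<close>

lemma kolmogorov_sup_moment:
  fixes Y :: "real \<Rightarrow> 'w \<Rightarrow> real" and p :: nat
  assumes p: "0 < p" and a: "1 < a" and C: "0 \<le> C"
    and int: "\<And>s t. s \<in> {0..1} \<Longrightarrow> t \<in> {0..1} \<Longrightarrow> integrable M (\<lambda>\<omega>. \<bar>Y t \<omega> - Y s \<omega>\<bar> ^ p)"
    and mom: "\<And>s t. s \<in> {0..1} \<Longrightarrow> t \<in> {0..1} \<Longrightarrow>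
      (\<integral>\<omega>. \<bar>Y t \<omega> - Y s \<omega>\<bar> ^ p \<partial>M) \<le> C * \<bar>t - s\<bar> powr a"
    and cont: "AE \<omega> in M. continuous_on {0..1} (\<lambda>t. Y t \<omega>)"
    and init: "AE \<omega> in M. Y 0 \<omega> = 0"
  obtains Z where "integrable M Z" and "AE \<omega> in M. \<forall>t\<in>{0..1}. \<bar>Y t \<omega>\<bar> ^ p \<le> Z \<omega>"
proof -
  \<comment> \<open>The \<open>2^n\<close> increments of level \<open>n\<close> have total
    \<open>p\<close>-th moment at most \<open>C * 2 powr (- n * (a - 1))\<close>. Half of this decay
    pays for the weight \<open>R^n\<close>, and the other half, \<open>c^n\<close>, makes the means
    summable; \<open>r\<close> is the \<open>p\<close>-th root of \<open>1 / R\<close>.\<close>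
  define R :: real where "R = 2 powr ((a - 1) / 2)"
  define r :: real where "r = 2 powr (- ((a - 1) / (2 * p)))"
  have R: "0 < R" by (simp add: R_def)
  have r: "0 < r" "r < 1"
    using a p by (auto simp: r_def powr_less_one)
  have rp: "r ^ p = 1 / R"
  proof -
    have "r ^ p = 2 powr (real p * - ((a - 1) / (2 * p)))"
      using p by (simp add: r_def powr_power)
    also have "real p * - ((a - 1) / (2 * p)) = - ((a - 1) / 2)"
      using p by simp
    finally show ?thesis
      by (simp add: R_def powr_minus_divide)
  qed
  define c where "c = 1 / R"
  have c: "0 < c" "c < 1"
    using a by (auto simp: c_def R_def)
  \<comment> \<open>Passing to the next level multiplies the weight by \<open>R\<close>, the number
    of increments by 2 and each moment bound by \<open>(1/2) powr a\<close>.\<close>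
  have Rc: "R * 2 * (1/2) powr a = c"
  proof -
    have "(1/2) powr a = (2::real) powr (- a)"
      by (simp add: powr_divide powr_minus_divide)
    then have "R * 2 * (1/2) powr a = 2 powr ((a - 1) / 2) * 2 powr 1 * 2 powr (- a)"
      by (simp only: R_def powr_one)
    also have "\<dots> = 2 powr ((a - 1) / 2 + 1 + - a)"
      by (simp only: powr_add)
    also have "(a - 1) / 2 + 1 + - a = - ((a - 1) / 2)"
      by (simp add: field_simps)
    finally show ?thesis
      by (simp add: c_def R_def powr_minus_divide)
  qed
  define D where "D n k \<omega> = \<bar>Y (real (Suc k) / 2^n) \<omega> - Y (real k / 2^n) \<omega>\<bar> ^ p" for n k \<omega>
  define F where "F n \<omega> = R^n * (\<Sum>k<2^n. D n k \<omega>)" for n \<omega>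
  have dy: "real k / 2^n \<in> {0..1}" if "k \<le> 2^n" for k n :: nat
    using that by (auto simp: divide_le_eq_1 simp flip: of_nat_le_iff)
  have D_int: "integrable M (D n k)" if "k < 2^n" for n k
    unfolding D_def using that by (intro int dy) auto
  have D_nn: "0 \<le> D n k \<omega>" for n k \<omega>
    by (simp add: D_def)
  have F_int: "integrable M (F n)" for n
    unfolding F_def using D_int by auto
  have F_nn: "0 \<le> F n \<omega>" for n \<omega>
    using R by (auto simp: F_def intro!: mult_nonneg_nonneg sum_nonneg D_nn)
  have D_mom: "(\<integral>\<omega>. D n k \<omega> \<partial>M) \<le> C * ((1/2) powr a)^n" if "k < 2^n" for n k
  proof -
    have "(\<integral>\<omega>. D n k \<omega> \<partial>M) \<le> C * \<bar>real (Suc k) / 2^n - real k / 2^n\<bar> powr a"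
      unfolding D_def using that by (intro mom dy) auto
    also have "real (Suc k) / 2^n - real k / 2^n = (1/2)^n"
      by (simp add: field_simps)
    also have "\<bar>(1/2::real)^n\<bar> powr a = ((1/2) powr a)^n"
      by (simp add: powr_powr powr_power mult.commute del: power_one_over flip: powr_realpow)
    finally show ?thesis .
  qed
  have F_mom: "(\<integral>\<omega>. F n \<omega> \<partial>M) \<le> C * c^n" for n
  proof -
    have "(\<integral>\<omega>. F n \<omega> \<partial>M) = R^n * (\<Sum>k<2^n. \<integral>\<omega>. D n k \<omega> \<partial>M)"
      unfolding F_def using D_int by (simp add: Bochner_Integration.integral_sum)
    also have "\<dots> \<le> R^n * (\<Sum>k<(2::nat)^n. C * ((1/2) powr a)^n)"
      using R D_mom by (intro mult_left_mono sum_mono) auto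
    also have "\<dots> = C * (R * 2 * (1/2) powr a)^n"
      by (simp add: power_mult_distrib)
    finally show ?thesis
      by (simp add: Rc)
  qed
  have summable_mom: "summable (\<lambda>n. \<integral>\<omega>. F n \<omega> \<partial>M)"
    by (rule summable_comparison_test'[of "\<lambda>n. C * c^n" 0])
      (use F_mom c in \<open>auto intro!: summable_mult summable_geometric simp: F_nn\<close>)
  \<comment> \<open>Summability of \<open>F n \<omega>\<close> is not yet known, so sum and integral
    are exchanged in \<open>ennreal\<close>; a finite mean then forces the series to converge almost
    everywhere.\<close>
  have "(\<integral>\<^sup>+\<omega>. (\<Sum>n. ennreal (F n \<omega>)) \<partial>M) = (\<Sum>n. \<integral>\<^sup>+\<omega>. ennreal (F n \<omega>) \<partial>M)"
    using F_int by (intro nn_integral_suminf) auto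
  also have "\<dots> = (\<Sum>n. ennreal (\<integral>\<omega>. F n \<omega> \<partial>M))"
    using F_int F_nn by (simp add: nn_integral_eq_integral)
  also have "\<dots> \<noteq> \<infinity>"
    using summable_mom F_nn by (simp add: ennreal_suminf_neq_top)
  finally have "AE \<omega> in M. (\<Sum>n. ennreal (F n \<omega>)) \<noteq> \<infinity>"
    using F_int by (intro nn_integral_noteq_infinite) auto
  then have summable_F: "AE \<omega> in M. summable (\<lambda>n. F n \<omega>)"
    by eventually_elim (rule summable_suminf_not_top, simp_all add: F_nn)
  \<comment> \<open>This is the \<open>p\<close>-th power of the chaining bound
    \<open>A / (1 - r)\<close> with \<open>A\<close> the \<open>p\<close>-th root of the
    series.\<close>
  define Z where "Z \<omega> = (1 / (1 - r)) ^ p * (\<Sum>n. F n \<omega>)" for \<omega>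
  have "integrable M Z"
    unfolding Z_def using F_int summable_F summable_mom F_nn
    by (intro integrable_mult_right integrable_suminf) auto
  moreover have "AE \<omega> in M. \<forall>t\<in>{0..1}. \<bar>Y t \<omega>\<bar> ^ p \<le> Z \<omega>"
    using cont init summable_F
  proof eventually_elim
    case (elim \<omega>)
    define z where "z = (\<Sum>n. F n \<omega>)"
    have z: "0 \<le> z"
      unfolding z_def using elim F_nn by (intro suminf_nonneg) auto
    have "\<bar>Y (real (Suc k) / 2^n) \<omega> - Y (real k / 2^n) \<omega>\<bar> \<le> root p z * r^n"
      if k: "k < 2^n" for n k
    proof -
      have "R^n * D n k \<omega> \<le> F n \<omega>"
        unfolding F_def using k R D_nn by (intro mult_left_mono member_le_sum) auto
      also have "\<dots> \<le> z"
        unfolding z_def using sum_le_suminf[of "\<lambda>n. F n \<omega>" "{n}"] elim F_nn by simp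
      finally have "D n k \<omega> \<le> z * (1 / R)^n"
        using R by (simp add: field_simps)
      also have "\<dots> = (root p z * r^n)^p"
        using z p by (simp add: power_mult_distrib mult.commute[of n p] power_mult rp flip: power_mult[of r n p])
      finally show ?thesis
        unfolding D_def using p z r by (simp add: power_mono_iff)
    qed
    then have sup: "\<bar>Y t \<omega>\<bar> \<le> root p z / (1 - r)" if "t \<in> {0..1}" for t
      using elim z r p that by (intro dyadic_chaining[where b = "\<lambda>t. Y t \<omega>"]) auto
    show ?case
    proof
      fix t :: real assume "t \<in> {0..1}"
      then have "\<bar>Y t \<omega>\<bar> ^ p \<le> (root p z / (1 - r)) ^ p"
        using sup by (intro power_mono) auto
      also have "\<dots> = Z \<omega>"
        using p z by (simp add: Z_def z_def power_divide)
      finally show "\<bar>Y t \<omega>\<bar> ^ p \<le> Z \<omega>" .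
    qed
  qed
  ultimately show ?thesis ..
qed

section \<open>Application to fractional Brownian motion\<close>

text \<open>The assumption on \<open>k\<close> makes the exponent of
  \<open>\<bar>t - s\<bar>\<close> in the \<open>2*k\<close>-th moment of an increment exceed 1,
  which compensates for the \<open>2^n\<close> increments of level \<open>n\<close>. The smaller
  \<open>H\<close> is, the higher the moment must be.\<close>

lemma fractional_brownian_motion_sup_moment:
  assumes "prob_space M" and H: "0 < H" and fbm: "fractional_brownian_motion M H B"
    and k: "1 < 2 * H * real k"
  obtains Z where "integrable M Z" and "AE \<omega> in M. \<forall>t\<in>{0..1}. \<bar>B t \<omega>\<bar> ^ (2*k) \<le> Z \<omega>"
proof -
  interpret prob_space M by fact
  have gauss: "gaussian_rv M (\<lambda>\<omega>. \<Sum>t\<in>J. c t * B t \<omega>)" if "finite J" "J \<subseteq> {0..1}" for J c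
    using fbm that by (auto simp: fractional_brownian_motion_def gaussian_process_on_def)
  have mean: "expectation (B t) = 0" if "t \<in> {0..1}" for t
    using fbm that by (auto simp: fractional_brownian_motion_def)
  have cov: "expectation (\<lambda>\<omega>. B t \<omega> * B s \<omega>)
      = 1/2 * (t powr (2*H) + s powr (2*H) - \<bar>t - s\<bar> powr (2*H))"
    if "s \<in> {0..1}" "t \<in> {0..1}" for s t
    using fbm that by (auto simp: fractional_brownian_motion_def)
  have B_gauss: "gaussian_rv M (B t)" if "t \<in> {0..1}" for t
    using gauss[of "{t}" "\<lambda>_. 1"] that by simp
  have meas: "B t \<in> borel_measurable M" if "t \<in> {0..1}" for t
    using B_gauss[OF that] by (simp add: gaussian_rv_def)
  have sq_int: "integrable M (\<lambda>\<omega>. (B t \<omega>)\<^sup>2)" if "t \<in> {0..1}" for t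
    using gaussian_rv_even_moment(1)[OF \<open>prob_space M\<close> B_gauss mean, of t 1] that by simp
  have B_int: "integrable M (B t)" if "t \<in> {0..1}" for t
    using square_integrable_imp_integrable[OF meas sq_int] that by simp
  have prod_int: "integrable M (\<lambda>\<omega>. B t \<omega> * B s \<omega>)" if "s \<in> {0..1}" "t \<in> {0..1}" for s t
  proof (rule Bochner_Integration.integrable_bound)
    show "integrable M (\<lambda>\<omega>. (B t \<omega>)\<^sup>2 + (B s \<omega>)\<^sup>2)"
      using sq_int that by auto
    have "\<bar>u * v\<bar> \<le> u\<^sup>2 + v\<^sup>2" for u v :: real
    proof -
      have "2 * \<bar>u * v\<bar> \<le> u\<^sup>2 + v\<^sup>2"
        using sum_squares_bound[of "\<bar>u\<bar>" "\<bar>v\<bar>"] by (simp add: abs_mult mult.assoc)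
      then show ?thesis
        using abs_ge_zero[of "u * v"] by linarith
    qed
    then show "AE \<omega> in M. norm (B t \<omega> * B s \<omega>) \<le> norm ((B t \<omega>)\<^sup>2 + (B s \<omega>)\<^sup>2)"
      by simp
  qed (use meas that in measurable)
  have variance: "expectation (\<lambda>\<omega>. (B t \<omega> - B s \<omega>)\<^sup>2) = \<bar>t - s\<bar> powr (2*H)"
    if st: "s \<in> {0..1}" "t \<in> {0..1}" for s t
  proof -
    have "expectation (\<lambda>\<omega>. (B t \<omega> - B s \<omega>)\<^sup>2)
      = expectation (\<lambda>\<omega>. B t \<omega> * B t \<omega> + B s \<omega> * B s \<omega> - 2 * (B t \<omega> * B s \<omega>))"
      by (simp add: power2_eq_square algebra_simps)
    also have "\<dots> = expectation (\<lambda>\<omega>. B t \<omega> * B t \<omega>) + expectation (\<lambda>\<omega>. B s \<omega> * B s \<omega>)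
        - 2 * expectation (\<lambda>\<omega>. B t \<omega> * B s \<omega>)"
      using prod_int st by simp
    also have "\<dots> = \<bar>t - s\<bar> powr (2*H)"
      unfolding cov[OF st] cov[OF st(1) st(1)] cov[OF st(2) st(2)] by (simp add: field_simps)
    finally show ?thesis .
  qed
  have incr_gauss: "gaussian_rv M (\<lambda>\<omega>. B t \<omega> - B s \<omega>)" if st: "s \<in> {0..1}" "t \<in> {0..1}" for s t
  \<comment> \<open>If \<open>s = t\<close>, the set \<open>{s, t}\<close> collapses and the
    coefficients below would yield \<open>B t\<close> instead of 0; the empty sum is used
    then.\<close>
  proof (cases "s = t")
    case True
    then show ?thesis
      using gauss[of "{}" "\<lambda>_. 0"] by simp
  next
    case False
    then show ?thesis
      using gauss[of "{s, t}" "\<lambda>u. if u = t then 1 else -1"] st by (simp add: algebra_simps)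
  qed
  \<comment> \<open>At \<open>s = t\<close> the conversion between \<open>^\<close> and
    \<open>powr\<close> has base 0, where \<open>0 ^ 0 = 1\<close> but \<open>0 powr 0 = 0\<close>;
    a nonzero exponent avoids the clash.\<close>
  have "k \<noteq> 0"
    using k by (cases k) auto
  define C :: real where "C = fact (2*k) / (2^k * fact k)"
  have incr: "integrable M (\<lambda>\<omega>. \<bar>B t \<omega> - B s \<omega>\<bar> ^ (2*k))"
      "(\<integral>\<omega>. \<bar>B t \<omega> - B s \<omega>\<bar> ^ (2*k) \<partial>M) = C * \<bar>t - s\<bar> powr (2 * H * real k)"
    if st: "s \<in> {0..1}" "t \<in> {0..1}" for s t
  proof -
    have "expectation (\<lambda>\<omega>. B t \<omega> - B s \<omega>) = 0"
      using B_int mean st by simp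
    from gaussian_rv_even_moment[OF \<open>prob_space M\<close> incr_gauss this, of k, OF st]
    show "integrable M (\<lambda>\<omega>. \<bar>B t \<omega> - B s \<omega>\<bar> ^ (2*k))"
      "(\<integral>\<omega>. \<bar>B t \<omega> - B s \<omega>\<bar> ^ (2*k) \<partial>M) = C * \<bar>t - s\<bar> powr (2 * H * real k)"
      using variance[OF st] powr_realpow'[of "\<bar>t - s\<bar> powr (2*H)" k] \<open>k \<noteq> 0\<close>
      by (auto simp: power_even_abs C_def powr_powr)
  qed
  \<comment> \<open>The start at 0 is not part of the definition; it follows from the covariance,
    which gives \<open>B 0\<close> a vanishing second moment.\<close>
  have init: "AE \<omega> in M. B 0 \<omega> = 0"
  proof -
    have "expectation (\<lambda>\<omega>. (B 0 \<omega>)\<^sup>2) = 0"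
      using cov[of 0 0] by (simp add: power2_eq_square)
    then show ?thesis
      using integral_nonneg_eq_0_iff_AE[OF sq_int[of 0]] by simp
  qed
  show ?thesis
  proof (rule kolmogorov_sup_moment[of "2*k" "2 * H * real k" C M B])
    show "0 < 2 * k"
      using \<open>k \<noteq> 0\<close> by simp
    show "0 \<le> C"
      by (simp add: C_def)
    show "AE \<omega> in M. continuous_on {0..1} (\<lambda>t. B t \<omega>)"
      using fbm by (simp add: fractional_brownian_motion_def)
  qed (use k incr init that in auto)
qed

section \<open>Sign of the drift and pathwise comparison\<close>

text \<open>The terms are grouped by sign: the power \<open>2*\<theta> + 1\<close> beats
  \<open>\<theta> + 1\<close>, the linear term is nonpositive for positive \<open>y\<close>, and the
  two singular terms share a factor that contains all dependence on \<open>s\<close>. Hence the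
  threshold for \<open>y\<close> is uniform in \<open>s\<close>.\<close>

lemma eventually_drift_nonpos:
  assumes "0 < H" "H < 1/2" "\<theta> > 0" "\<rho> > 1 + 1 / (H * \<theta>)" "\<sigma> > 0" "am1 > 0" "a1 > 0"
  shows "\<forall>\<^sub>F y in at_top. \<forall>s. drift H \<theta> \<rho> \<sigma> am1 a0 a1 a2 s y \<le> 0"
proof -
  \<comment> \<open>\<open>\<delta>\<close> is the gap between the two singular terms: the repelling
    exponent equals \<open>- 1 - \<delta>\<close>. It is positive because
    \<open>\<theta> * \<rho> > \<theta> + 1 / H\<close> and \<open>1 / H > 2\<close>.\<close>
  define \<delta> where "\<delta> = \<theta> * \<rho> - \<theta> - 2"
  have "\<theta> * \<rho> > \<theta> * (1 + 1 / (H * \<theta>))"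
    using assms by simp
  also have "\<theta> * (1 + 1 / (H * \<theta>)) = \<theta> + 1 / H"
    using assms by (simp add: field_simps)
  finally have "\<theta> * \<rho> > \<theta> + 1 / H" .
  moreover have "2 < 1 / H"
    using assms by (simp add: field_simps)
  ultimately have "\<delta> > 0"
    unfolding \<delta>_def by linarith
  have "\<forall>\<^sub>F y in at_top. a0 / (am1 * \<theta>) \<le> y powr \<theta>"
    using eventually_ge_at_top[of "\<bar>a0 / (am1 * \<theta>)\<bar> powr (1 / \<theta>)"]
  proof eventually_elim
    case (elim y)
    then have "(\<bar>a0 / (am1 * \<theta>)\<bar> powr (1 / \<theta>)) powr \<theta> \<le> y powr \<theta>"
      using \<open>\<theta> > 0\<close> by (intro powr_mono2) auto
    moreover have "(\<bar>a0 / (am1 * \<theta>)\<bar> powr (1 / \<theta>)) powr \<theta> = \<bar>a0 / (am1 * \<theta>)\<bar>"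
      using \<open>\<theta> > 0\<close> unfolding powr_powr by simp
    ultimately show ?case
      by linarith
  qed
  moreover have "((\<lambda>y. a2 * (1 / \<theta> powr \<rho>) * y powr (-\<delta>)) \<longlongrightarrow> a2 * (1 / \<theta> powr \<rho>) * 0) at_top"
    using \<open>\<delta> > 0\<close> by (intro tendsto_intros tendsto_neg_powr filterlim_ident) auto
  then have "\<forall>\<^sub>F y in at_top. a2 * (1 / \<theta> powr \<rho>) * y powr (-\<delta>) < \<sigma> * H * (\<theta> + 1)"
    by (rule order_tendstoD) (use assms in simp)
  ultimately show ?thesis
    using eventually_gt_at_top[of 0]
  proof eventually_elim
    case (elim y)
    show ?case
    proof
      fix s
      have "- am1 * \<theta> * y powr (2*\<theta> + 1) + a0 * y powr (\<theta> + 1)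
          = y powr (\<theta> + 1) * (a0 - am1 * \<theta> * y powr \<theta>)"
        by (simp add: algebra_simps flip: powr_add)
      also have "\<dots> \<le> 0"
        using elim assms by (intro mult_nonneg_nonpos) (auto simp: field_simps)
      finally have 1: "- am1 * \<theta> * y powr (2*\<theta> + 1) + a0 * y powr (\<theta> + 1) \<le> 0" .
      have "- \<theta> * \<rho> + \<theta> + 1 = - 1 + - \<delta>"
        by (simp add: \<delta>_def)
      then have "y powr (- \<theta> * \<rho> + \<theta> + 1) = y powr (-1) * y powr (-\<delta>)"
        by (simp only: powr_add)
      then have "a2 * s powr (2*H - 1) * (1 / \<theta> powr \<rho>) * y powr (- \<theta> * \<rho> + \<theta> + 1)
          - \<sigma> * H * s powr (2*H - 1) * (\<theta> + 1) * y powr (-1)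
        = s powr (2*H - 1) * y powr (-1) *
          (a2 * (1 / \<theta> powr \<rho>) * y powr (-\<delta>) - \<sigma> * H * (\<theta> + 1))"
        by (simp only: algebra_simps)
      \<comment> \<open>\<open>powr\<close> is nonnegative at every real base, so the negative
        bracket decides the sign for all \<open>s\<close>.\<close>
      also have "\<dots> \<le> 0"
        using elim by (intro mult_nonneg_nonpos) auto
      finally have 2: "a2 * s powr (2*H - 1) * (1 / \<theta> powr \<rho>) * y powr (- \<theta> * \<rho> + \<theta> + 1)
          - \<sigma> * H * s powr (2*H - 1) * (\<theta> + 1) * y powr (-1) \<le> 0" .
      have "a1 * (y / \<theta>) \<ge> 0"
        using elim assms by simp
      with 1 2 show "drift H \<theta> \<rho> \<sigma> am1 a0 a1 a2 s y \<le> 0"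
        unfolding drift_def by linarith
    qed
  qed
qed

text \<open>Compare \<open>u t\<close> with \<open>u\<close> at the last time before \<open>t\<close> at which \<open>u\<close> does not exceed \<open>K\<close>.\<close>

lemma integral_equation_upper_bound:
  fixes u b h :: "real \<Rightarrow> real"
  assumes cont: "continuous_on {0..1} u"
    and int: "\<And>t. t \<in> {0..1} \<Longrightarrow> set_integrable lborel {0..t} h"
    and eq: "\<And>t. t \<in> {0..1} \<Longrightarrow> u t = x + (LINT s:{0..t}|lborel. h s) - \<sigma> * b t"
    and h: "\<And>s. s \<in> {0..1} \<Longrightarrow> K \<le> u s \<Longrightarrow> h s \<le> 0"
    and b: "\<And>s. s \<in> {0..1} \<Longrightarrow> \<bar>b s\<bar> \<le> S"
    and "0 \<le> \<sigma>" "x \<le> K" and t: "t \<in> {0..1}"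
  shows "u t \<le> K + 2 * \<sigma> * S"
proof -
  have \<sigma>b: "\<bar>\<sigma> * b s\<bar> \<le> \<sigma> * S" if "s \<in> {0..1}" for s
    using b[OF that] \<open>0 \<le> \<sigma>\<close> by (simp add: abs_mult mult_left_mono)
  \<comment> \<open>This covers arbitrary \<open>I\<close>, since the integral of a non-integrable
    function is 0 by convention.\<close>
  have nonpos: "(LINT s:I|lborel. h s) \<le> 0" if "\<And>s. s \<in> I \<Longrightarrow> s \<in> {0..1} \<and> K \<le> u s" for I
  proof -
    have "0 \<le> (LINT s|lborel. - (indicator I s *\<^sub>R h s))"
      by (rule Bochner_Integration.integral_nonneg) (use that h in \<open>auto simp: indicator_def\<close>)
    then show ?thesis
      by (simp add: set_lebesgue_integral_def)
  qed
  define T where "T = {s \<in> {0..t}. u s \<le> K}"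
  show ?thesis
  proof (cases "T = {}")
    \<comment> \<open>As \<open>u 0 = x - \<sigma> * b 0\<close> may exceed \<open>K\<close>, there
      may be no time below \<open>K\<close>; the integral over all of \<open>{0..t}\<close> is then
      nonpositive, and \<open>x \<le> K\<close> replaces the value at the last time.\<close>
    case True
    then have "(LINT s:{0..t}|lborel. h s) \<le> 0"
      using t by (intro nonpos) (use True in \<open>fastforce simp: T_def\<close>)
    then show ?thesis
      using eq[OF t] \<sigma>b[OF t] \<open>x \<le> K\<close> by linarith
  next
    case False
    have "T = {0..t} \<inter> u -` {..K}"
      by (auto simp: T_def)
    moreover have "closed ({0..t} \<inter> u -` {..K})"
      using t by (intro continuous_closed_preimage continuous_on_subset[OF cont]) auto
    ultimately have "closed T"
      by simp
    have bdd: "bdd_above T"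
      by (rule bdd_aboveI[of _ t]) (auto simp: T_def)
    define \<tau> where "\<tau> = Sup T"
    have "\<tau> \<in> T"
      unfolding \<tau>_def using False bdd \<open>closed T\<close> by (rule closed_contains_Sup)
    then have \<tau>: "\<tau> \<in> {0..t}" "u \<tau> \<le> K"
      by (auto simp: T_def)
    then have \<tau>1: "\<tau> \<in> {0..1}"
      using t by simp
    have above: "K \<le> u s" if "s \<in> {\<tau><..t}" for s
      using cSup_upper[OF _ bdd, of s] that \<tau> by (force simp: T_def \<tau>_def)
    have "{0..t} = {0..\<tau>} \<union> {\<tau><..t}"
      using \<tau> by auto
    then have "(LINT s:{0..t}|lborel. h s)
        = (LINT s:{0..\<tau>}|lborel. h s) + (LINT s:{\<tau><..t}|lborel. h s)"
      using \<tau> by (auto intro!: set_integral_Un set_integrable_subset[OF int[OF t]])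
    moreover have "(LINT s:{\<tau><..t}|lborel. h s) \<le> 0"
      using \<tau> t above by (intro nonpos) auto
    \<comment> \<open>Subtracting the equations at \<open>t\<close> and \<open>\<tau>\<close> leaves
      the integral after \<open>\<tau>\<close> and two noise terms, each at most
      \<open>\<sigma> * S\<close>; hence the factor 2.\<close>
    ultimately show ?thesis
      using eq[OF t] eq[OF \<tau>1] \<sigma>b[OF t] \<sigma>b[OF \<tau>1] \<tau>(2) by linarith
  qed
qed

section \<open>Measurability and moments of the solution\<close>

text \<open>Adaptedness refers to the completed filtration, whereas \<open>Lq_space\<close> asks for
  measurability with respect to \<open>M\<close>. All generators, including the null sets, lie in
  \<open>sets M\<close>.\<close>

lemma completed_filtration_measurable:
  assumes "Y \<in> borel_measurable (completed_filtration M B t)"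
    and "\<And>s. s \<in> {0..t} \<Longrightarrow> B s \<in> borel_measurable M"
  shows "Y \<in> borel_measurable M"
proof -
  let ?G = "{B s -` A \<inter> space M | s A. s \<in> {0..t} \<and> A \<in> sets borel} \<union> null_sets M"
  have G: "?G \<subseteq> sets M"
    using assms(2) by (auto intro: measurable_sets)
  moreover have "?G \<subseteq> Pow (space M)"
    using G sets.space_closed by blast
  ultimately have "subalgebra M (completed_filtration M B t)"
    by (simp add: subalgebra_def completed_filtration_def sets.sigma_sets_subset)
  then show ?thesis
    using assms(1) by (rule measurable_from_subalg)
qed

theorem theorem4p1:
  fixes M :: "'w measure"
    and H \<theta> \<rho> \<sigma> am1 a0 a1 a2 x :: real
    and B X :: "real \<Rightarrow> 'w \<Rightarrow> real"
  assumes "prob_space M" and "complete_measure M"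
    and "0 < H" and "H < 1/2"
    and "\<theta> > 0" and "\<rho> > 1 + 1 / (H * \<theta>)" and "\<sigma> > 0"
    and "am1 > 0" and "a0 > 0" and "a1 > 0" and "a2 > 0" and "x > 0"
    and "fractional_brownian_motion M H B"
    and "strong_positive_solution M B (drift H \<theta> \<rho> \<sigma> am1 a0 a1 a2) \<sigma> x X"
  shows "\<forall>q\<ge>1. \<forall>t\<in>{0..1}. X t \<in> Lq_space M q"
proof (intro allI impI ballI)
  fix q t :: real
  assume q: "1 \<le> q" and t: "t \<in> {0..1}"
  interpret prob_space M by fact
  let ?f = "drift H \<theta> \<rho> \<sigma> am1 a0 a1 a2"
  have adapted: "X t \<in> borel_measurable (completed_filtration M B t)"
    and cont: "AE \<omega> in M. continuous_on {0..1} (\<lambda>t. X t \<omega>)"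
    and pos: "AE \<omega> in M. \<forall>t\<in>{0..1}. X t \<omega> > 0"
    and eq: "AE \<omega> in M. \<forall>t\<in>{0..1}.
        set_integrable lborel {0..t} (\<lambda>s. ?f s (X s \<omega>)) \<and>
        X t \<omega> = x + (LINT s:{0..t}|lborel. ?f s (X s \<omega>)) - \<sigma> * B t \<omega>"
    using assms(14) t unfolding strong_positive_solution_def by blast+
  have "B s \<in> borel_measurable M" if "s \<in> {0..t}" for s
    using assms(13) that t by (auto simp: fractional_brownian_motion_def gaussian_process_on_def)
  then have meas[measurable]: "X t \<in> borel_measurable M"
    by (rule completed_filtration_measurable[OF adapted])
  \<comment> \<open>A single even exponent \<open>2*k\<close> dominates the real exponent
    \<open>q\<close> and is high enough for the moment of the supremum of \<open>B\<close>.\<close>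
  obtain k :: nat where "max q (1 / H) < real k"
    using reals_Archimedean2 by blast
  then have k: "q \<le> real (2*k)" "1 < 2 * H * real k"
    using \<open>0 < H\<close> q by (auto simp: field_simps)
  obtain Z where Z: "integrable M Z" "AE \<omega> in M. \<forall>t\<in>{0..1}. \<bar>B t \<omega>\<bar> ^ (2*k) \<le> Z \<omega>"
    by (rule fractional_brownian_motion_sup_moment[OF \<open>prob_space M\<close> \<open>0 < H\<close> assms(13) k(2)])
  obtain K0 where K0: "\<And>y s. K0 \<le> y \<Longrightarrow> ?f s y \<le> 0"
    using eventually_drift_nonpos[OF assms(3-8) assms(10), of a0 a2]
    unfolding eventually_at_top_linorder by blast
  \<comment> \<open>\<open>x\<close> and \<open>K0\<close> serve the pathwise comparison; the lower
    bound 1 makes \<open>powr\<close> monotone in the exponent when \<open>q\<close> is raised to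
    \<open>2*k\<close>.\<close>
  define K where "K = max 1 (max x K0)"
  have K: "1 \<le> K" "x \<le> K" "K0 \<le> K"
    by (auto simp: K_def)
  have p: "0 < 2*k"
    using k q by (cases k) auto
  have bound: "AE \<omega> in M. \<bar>X t \<omega>\<bar> powr q \<le> 2^(2*k) * (K^(2*k) + (2*\<sigma>)^(2*k) * Z \<omega>)"
    using Z(2) cont pos eq
  proof eventually_elim
    case (elim \<omega>)
    have Z0: "0 \<le> Z \<omega>"
      using elim(1) t by (meson order_trans zero_le_power abs_ge_zero)
    define S where "S = root (2*k) (Z \<omega>)"
    have S: "0 \<le> S" "S ^ (2*k) = Z \<omega>"
      using Z0 p by (auto simp: S_def)
    have "\<bar>B s \<omega>\<bar> \<le> S" if "s \<in> {0..1}" for s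
      using elim(1) that S p by (metis abs_ge_zero power_mono_iff)
    then have "X t \<omega> \<le> K + 2 * \<sigma> * S"
      by (intro integral_equation_upper_bound[OF elim(2), where b = "\<lambda>s. B s \<omega>" and x = x])
        (use elim(4) K0 K t \<open>\<sigma> > 0\<close> in auto)
    moreover have "0 < X t \<omega>"
      using elim(3) t by auto
    ultimately have "\<bar>X t \<omega>\<bar> powr q \<le> (K + 2 * \<sigma> * S) powr q"
      using q by (intro powr_mono2) auto
    also have "\<dots> \<le> (K + 2 * \<sigma> * S) powr real (2*k)"
      using K S \<open>\<sigma> > 0\<close> k by (intro powr_mono) (auto intro: add_increasing2)
    also have "\<dots> = (K + 2 * \<sigma> * S) ^ (2*k)"
      using K S \<open>\<sigma> > 0\<close> by (intro powr_realpow) (auto intro: add_pos_nonneg)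
    \<comment> \<open>Bounding a sum by twice the maximum separates the constant \<open>K\<close>
      from the random \<open>S\<close>, at the cost of the factor \<open>2^(2*k)\<close>.\<close>
    also have "\<dots> \<le> (2 * max K (2 * \<sigma> * S)) ^ (2*k)"
      using K S \<open>\<sigma> > 0\<close> by (intro power_mono) auto
    also have "\<dots> = 2^(2*k) * max K (2 * \<sigma> * S) ^ (2*k)"
      by (simp add: power_mult_distrib)
    also have "max K (2 * \<sigma> * S) ^ (2*k) \<le> K^(2*k) + (2 * \<sigma> * S)^(2*k)"
      using K S \<open>\<sigma> > 0\<close> by (auto simp: max_def)
    finally show ?case
      using S by (simp add: power_mult_distrib)
  qed
  have "integrable M (\<lambda>\<omega>. 2^(2*k) * (K^(2*k) + (2*\<sigma>)^(2*k) * Z \<omega>))"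
    using Z(1) by auto
  then have "integrable M (\<lambda>\<omega>. \<bar>X t \<omega>\<bar> powr q)"
  proof (rule Bochner_Integration.integrable_bound)
    show "AE \<omega> in M. norm (\<bar>X t \<omega>\<bar> powr q)
        \<le> norm (2^(2*k) * (K^(2*k) + (2*\<sigma>)^(2*k) * Z \<omega>))"
      using bound
      by eventually_elim
        (simp only: real_norm_def abs_of_nonneg powr_ge_zero order_trans[OF _ abs_ge_self])
  qed simp
  then show "X t \<in> Lq_space M q"
    by (simp add: Lq_space_def)
qed

end
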